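(* Let $\Omega=(0,1)^2$ (so $d=2$), $a=43/64$, $\boldsymbol\xi_1=(1,\sqrt2-1)^T$, $\boldsymbol\xi_2=(\sqrt2-1,1)^T$, $\Upsilon_1=\{(x,y)\in\Omega:y<x\}$, $\Upsilon_2=\{(x,y)\in\Omega:y\ge x\}$, $$\Omega_1=\{\mathbf{x}\in\Upsilon_1:\boldsymbol\xi_1\cdot\mathbf{x}<a\}\cup\{\mathbf{x}\in\Upsilon_2:\boldsymbol\xi_2\cdot\mathbf{x}<a\},\qquad\Omega_2=\Omega\setminus\bar\Omega_1,$$ and let $\bm\beta$ be the piecewise constant vector field equal to $(1-\sqrt2,1)^T$ on $\Upsilon_1$ and $(-1,\sqrt2-1)^T$ on $\Upsilon_2$. Let $\alpha_1<\alpha_2$ be real numbers, and let $\chi=\alpha_1$ on $\Omega_1$ and $\chi=\alpha_2$ on $\Omega_2$. For any $\varepsilon>0$ such that the intersections of $\Omega$ with the lines $\boldsymbol\xi_i\cdot\mathbf{x}=a\pm\varepsilon$, $i=1,2$, are not empty, let $$p_i(\mathbf{x})=\alpha_1+\frac{\alpha_2-\alpha_1}{2\varepsilon}\Big(\sigma(\boldsymbol\xi_i\cdot\mathbf{x}-a+\varepsilon)-\sigma(\boldsymbol\xi_i\cdot\mathbf{x}-a-\varepsilon)\Big),\quad i=1,2,$$ and $p(\mathbf{x})=\max\{p_1(\mathbf{x}),p_2(\mathbf{x})\}$. Then $$\|\chi-p\|_{L^2(\Omega)}=\left(\|\chi-p\|_{L^2(\Omega)}^2+\|\chi_{\bm\beta}-p_{\bm\beta}\|_{L^2(\Omega)}^2\right)^{1/2}\le\sqrt{\frac23}\,D^{(d-1)/2}\,|\alpha_1-\alpha_2|\,\sqrt{\varepsilon},$$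 where $D$ is the diameter of $\Omega$.
   Context: $\sigma(t)=\max\{0,t\}$ is the ReLU activation function. $v_{\bm\beta}=\bm\beta\cdot\nabla v$ denotes the (weak) directional derivative along $\bm\beta$; since $\bm\beta$ is piecewise constant it is understood on each of the (interiors of the) regions $\Upsilon_1,\Upsilon_2$. The vector $\boldsymbol\xi_i$ is normal to $\bm\beta|_{\Upsilon_i}$. *)

theory Defs
  imports "HOL-Analysis.Analysis"
begin

section \<open>The space \<open>L\<^sup>2(S)\<close>\<close>

definition L2 :: "'a::euclidean_space set \<Rightarrow> ('a \<Rightarrow> real) set" where
  "L2 S = {f. f \<in> borel_measurable (lebesgue_on S) \<and> integrable (lebesgue_on S) (\<lambda>x. (f x)\<^sup>2)}"

text \<open>Only meaningful for members of \<^const>\<open>L2\<close> (the Bochner integral of a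
  non-integrable function is 0).\<close>

definition L2norm :: "'a::euclidean_space set \<Rightarrow> ('a \<Rightarrow> real) \<Rightarrow> real" where
  "L2norm S f = sqrt (\<integral>x. (f x)\<^sup>2 \<partial>lebesgue_on S)"


section \<open>Weak directional derivatives\<close>

primrec Ck :: "nat \<Rightarrow> ('a::euclidean_space \<Rightarrow> real) \<Rightarrow> bool" where
  "Ck 0 f \<longleftrightarrow> continuous_on UNIV f"
| "Ck (Suc k) f \<longleftrightarrow> (\<forall>x. f differentiable (at x)) \<and>
     (\<forall>b\<in>Basis. Ck k (\<lambda>x. frechet_derivative f (at x) b))"

text \<open>\<open>C\<^sub>c\<^sup>\<infinity>(U)\<close>, each function being extended by 0 to the whole space.\<close>

definition test_functions :: "'a::euclidean_space set \<Rightarrow> ('a \<Rightarrow> real) set" where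
  "test_functions U =
     {\<phi>. (\<forall>k. Ck k \<phi>) \<and> compact (closure {x. \<phi> x \<noteq> 0}) \<and> closure {x. \<phi> x \<noteq> 0} \<subseteq> U}"

definition locally_integrable :: "'a::euclidean_space set \<Rightarrow> ('a \<Rightarrow> real) \<Rightarrow> bool" where
  "locally_integrable U f \<longleftrightarrow> (\<forall>K. compact K \<and> K \<subseteq> U \<longrightarrow> f absolutely_integrable_on K)"

text \<open>On the open set \<open>U\<close>, \<open>g\<close> is a weak derivative of \<open>v\<close> along the constant vector \<open>b\<close>.\<close>

definition has_weak_dir_deriv ::
    "'a::euclidean_space set \<Rightarrow> 'a \<Rightarrow> ('a \<Rightarrow> real) \<Rightarrow> ('a \<Rightarrow> real) \<Rightarrow> bool" where
  "has_weak_dir_deriv U b v g \<longleftrightarrow> locally_integrable U v \<and> locally_integrable U g \<and>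
     (\<forall>\<phi>\<in>test_functions U.
        (\<integral>x. v x * frechet_derivative \<phi> (at x) b \<partial>lebesgue_on U) =
        - (\<integral>x. g x * \<phi> x \<partial>lebesgue_on U))"

text \<open>For a vector field \<open>B\<close> that is constant on each member of \<open>P\<close>, the weak derivative
  along \<open>B\<close> is taken separately on the interior of each member. It is thus determined almost
  everywhere on the union of these interiors, and unconstrained elsewhere.\<close>

definition has_piecewise_weak_deriv ::
    "'a::euclidean_space set set \<Rightarrow> ('a \<Rightarrow> 'a) \<Rightarrow> ('a \<Rightarrow> real) \<Rightarrow> ('a \<Rightarrow> real) \<Rightarrow> bool" where
  "has_piecewise_weak_deriv P B v g \<longleftrightarrow>
     (\<forall>U\<in>P. \<exists>b. (\<forall>x\<in>U. B x = b) \<and> has_weak_dir_deriv (interior U) b v g)"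


section \<open>Domain, interface and advection field\<close>

definition \<Omega> :: "(real^2) set" where
  "\<Omega> = {x. 0 < x$1 \<and> x$1 < 1 \<and> 0 < x$2 \<and> x$2 < 1}"

definition lev :: real where
  "lev = 43/64"

definition \<xi>\<^sub>1 :: "real^2" where
  "\<xi>\<^sub>1 = vector [1, sqrt 2 - 1]"

definition \<xi>\<^sub>2 :: "real^2" where
  "\<xi>\<^sub>2 = vector [sqrt 2 - 1, 1]"

definition \<Upsilon>\<^sub>1 :: "(real^2) set" where
  "\<Upsilon>\<^sub>1 = {x\<in>\<Omega>. x$2 < x$1}"

definition \<Upsilon>\<^sub>2 :: "(real^2) set" where
  "\<Upsilon>\<^sub>2 = {x\<in>\<Omega>. x$2 \<ge> x$1}"

definition \<Omega>\<^sub>1 :: "(real^2) set" where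
  "\<Omega>\<^sub>1 = {x\<in>\<Upsilon>\<^sub>1. \<xi>\<^sub>1 \<bullet> x < lev} \<union> {x\<in>\<Upsilon>\<^sub>2. \<xi>\<^sub>2 \<bullet> x < lev}"

definition \<Omega>\<^sub>2 :: "(real^2) set" where
  "\<Omega>\<^sub>2 = \<Omega> - closure \<Omega>\<^sub>1"

text \<open>The value outside \<open>\<Upsilon>\<^sub>1 \<union> \<Upsilon>\<^sub>2 = \<Omega>\<close> is irrelevant.\<close>

definition \<beta> :: "real^2 \<Rightarrow> real^2" where
  "\<beta> x = (if x \<in> \<Upsilon>\<^sub>1 then vector [1 - sqrt 2, 1] else vector [-1, sqrt 2 - 1])"


section \<open>The ReLU approximation\<close>

definition relu :: "real \<Rightarrow> real" where
  "relu t = max 0 t"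

definition ramp :: "real \<Rightarrow> real \<Rightarrow> real \<Rightarrow> real^2 \<Rightarrow> real^2 \<Rightarrow> real" where
  "ramp \<alpha>\<^sub>1 \<alpha>\<^sub>2 \<epsilon> \<xi> x =
     \<alpha>\<^sub>1 + (\<alpha>\<^sub>2 - \<alpha>\<^sub>1) / (2 * \<epsilon>) * (relu (\<xi> \<bullet> x - lev + \<epsilon>) - relu (\<xi> \<bullet> x - lev - \<epsilon>))"

definition p :: "real \<Rightarrow> real \<Rightarrow> real \<Rightarrow> real^2 \<Rightarrow> real" where
  "p \<alpha>\<^sub>1 \<alpha>\<^sub>2 \<epsilon> x = max (ramp \<alpha>\<^sub>1 \<alpha>\<^sub>2 \<epsilon> \<xi>\<^sub>1 x) (ramp \<alpha>\<^sub>1 \<alpha>\<^sub>2 \<epsilon> \<xi>\<^sub>2 x)"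

end

theory Submission
  imports Defs
begin

text \<open>
  The maximum selects \<open>p\<^sub>i\<close> on \<open>\<Upsilon>\<^sub>i\<close>, because \<open>\<xi>\<^sub>i \<bullet> x\<close> is the larger of the two products there.
  So on \<open>\<Upsilon>\<^sub>i\<close> both \<open>\<chi>\<close> and \<open>p\<close> depend on \<open>\<xi>\<^sub>i \<bullet> x\<close> only, hence are invariant under translations
  along \<open>\<beta>\<close>; moving the translation onto a test function shows that both weak derivatives
  vanish. By the fundamental lemma of the calculus of variations every other choice of weak
  derivatives vanishes almost everywhere.

  For the \<open>L\<^sup>2\<close> bound, \<open>\<bar>\<chi> - p\<bar>\<close> is at most \<open>\<bar>\<alpha>\<^sub>1 - \<alpha>\<^sub>2\<bar> / 2\<close> in the strip of half-width \<open>\<epsilon> / 2\<close>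
  around the interface, at most \<open>\<bar>\<alpha>\<^sub>1 - \<alpha>\<^sub>2\<bar> / 4\<close> in the rest of the strip of half-width \<open>\<epsilon>\<close>, and
  0 elsewhere. A shear maps each of the two straight strips of half-width \<open>r\<close> into a rectangle of
  area \<open>2 * r\<close>, so the squared norm is at most \<open>5/8 * (\<alpha>\<^sub>1 - \<alpha>\<^sub>2)\<^sup>2 * \<epsilon>\<close>, while the diameter is at
  least 1.
\<close>

section \<open>Smooth functions\<close>

text \<open>\<open>flat 0\<close> is the classical smooth function that is flat at 0. Allowing every
  power of \<open>t\<close> in the denominator closes the family, up to linear combinations, under
  differentiation.\<close>

definition flat :: "nat \<Rightarrow> real \<Rightarrow> real" where
  "flat n t = (if 0 < t then exp (- 1 / t) / t ^ n else 0)"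

text \<open>With u = 1/t the limit from the right becomes that of u^n / exp u at infinity; to the
  left of 0 the function is 0.\<close>

lemma flat_tendsto_0: "(flat n \<longlongrightarrow> 0) (at 0)"
proof -
  have "((\<lambda>t::real. inverse t ^ n / exp (inverse t)) \<longlongrightarrow> 0) (at_right 0)"
    using filterlim_compose[OF tendsto_power_div_exp_0 filterlim_inverse_at_top_right] .
  then have "(flat n \<longlongrightarrow> 0) (at_right 0)"
    by (rule tendsto_cong[THEN iffD1, rotated])
      (auto simp: flat_def eventually_at_right_field exp_minus field_simps intro!: exI[of _ 1])
  moreover have "(flat n \<longlongrightarrow> 0) (at_left 0)"
    by (rule tendsto_eventually) (auto simp: flat_def eventually_at_left_field intro!: exI[of _ "-1"])
  ultimately show ?thesis
    by (simp add: filterlim_split_at)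
qed

lemma DERIV_flat:
  "(flat n has_real_derivative flat (n + 2) t - real n * flat (n + 1) t) (at t)"
proof -
  consider "t > 0" | "t < 0" | "t = 0" by linarith
  then show ?thesis
  proof cases
    case 1
    \<comment> \<open>The exponent in the derivative of \<open>t ^ n\<close> is truncated for
      \<open>n = 0\<close>; the factor \<open>real n\<close> makes both sides vanish there.\<close>
    have n: "real n * t ^ (n - Suc 0) = real n * (t ^ n / t)"
      using 1 by (cases n) auto
    have "((\<lambda>s. exp (- 1 / s) / s ^ n) has_real_derivative flat (n + 2) t - real n * flat (n + 1) t) (at t)"
      using 1 n by (auto intro!: derivative_eq_intros simp: flat_def field_simps power2_eq_square)
    then show ?thesis
      by (rule DERIV_cong_ev[THEN iffD1, rotated -1])
        (use 1 in \<open>auto simp: flat_def eventually_nhds intro!: exI[of _ "{0<..}"]\<close>)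
  next
    case 2
    have "((\<lambda>s. 0) has_real_derivative flat (n + 2) t - real n * flat (n + 1) t) (at t)"
      using 2 by (auto simp: flat_def)
    then show ?thesis
      by (rule DERIV_cong_ev[THEN iffD1, rotated -1])
        (use 2 in \<open>auto simp: flat_def eventually_nhds intro!: exI[of _ "{..<0}"]\<close>)
  next
    case 3
    \<comment> \<open>The difference quotient at 0 is again a member of the family, so
      differentiability at 0 reduces to the limit already known.\<close>
    have "(\<lambda>h. (flat n (0 + h) - flat n 0) / h) = flat (n + 1)"
      by (auto simp: flat_def fun_eq_iff)
    then have "(flat n has_real_derivative 0) (at 0)"
      using flat_tendsto_0[of "n + 1"] unfolding DERIV_def by simp
    then show ?thesis
      using 3 by (simp add: flat_def)
  qed
qed

section \<open>Closure properties of the classes \<open>Ck\<close>\<close>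

text \<open>The product rule leaves one factor undifferentiated, so the induction for products has
  to lower the order of that factor.\<close>

lemma Ck_SucD: "Ck (Suc k) f \<Longrightarrow> Ck k f"
proof (induction k arbitrary: f)
  case 0
  then show ?case
    by (auto simp: continuous_on_eq_continuous_at intro: differentiable_imp_continuous_within)
next
  case (Suc k)
  then show ?case by (simp del: Ck.simps(2) add: Ck.simps(2)[of "Suc k"] Ck.simps(2)[of k])
qed

lemma Ck_const: "Ck k (\<lambda>_. c)"
  by (induction k arbitrary: c) auto

lemma Ck_add: "Ck k f \<Longrightarrow> Ck k g \<Longrightarrow> Ck k (\<lambda>x. f x + g x)"
proof (induction k arbitrary: f g)
  case 0
  then show ?case by (auto intro: continuous_intros)
next
  case (Suc k)
  have "frechet_derivative (\<lambda>x. f x + g x) (at x) =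
      (\<lambda>h. frechet_derivative f (at x) h + frechet_derivative g (at x) h)" for x
    using Suc.prems by (intro frechet_derivative_at[symmetric] has_derivative_add)
      (auto simp: frechet_derivative_works)
  then show ?case
    using Suc by auto
qed

lemma Ck_mult: "Ck k f \<Longrightarrow> Ck k g \<Longrightarrow> Ck k (\<lambda>x. f x * g x)"
proof (induction k arbitrary: f g)
  case 0
  then show ?case by (auto intro: continuous_intros)
next
  case (Suc k)
  have "frechet_derivative (\<lambda>x. f x * g x) (at x) =
      (\<lambda>h. f x * frechet_derivative g (at x) h + frechet_derivative f (at x) h * g x)" for x
    using Suc.prems by (intro frechet_derivative_at[symmetric] has_derivative_mult)
      (auto simp: frechet_derivative_works)
  then show ?case
    using Suc Ck_SucD[OF Suc.prems(1)] Ck_SucD[OF Suc.prems(2)] by (auto intro!: Ck_add)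
qed

lemma Ck_prod: "finite I \<Longrightarrow> (\<And>i. i \<in> I \<Longrightarrow> Ck k (f i)) \<Longrightarrow> Ck k (\<lambda>x. \<Prod>i\<in>I. f i x)"
  by (induction rule: finite_induct) (auto intro: Ck_const Ck_mult)

text \<open>The chain rule gives members with indices \<open>n + 1\<close> and \<open>n + 2\<close>,
  so the induction on \<open>k\<close> keeps \<open>n\<close> arbitrary.\<close>

lemma Ck_flat:
  fixes v :: "'a::euclidean_space"
  shows "Ck k (\<lambda>x. flat n (v \<bullet> x + c))"
proof (induction k arbitrary: n)
  have D: "((\<lambda>x. flat n (v \<bullet> x + c)) has_derivative
    (\<lambda>h. (flat (n + 2) (v \<bullet> x + c) - real n * flat (n + 1) (v \<bullet> x + c)) * (v \<bullet> h))) (at x)" for n x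
    by (rule has_derivative_compose[OF _ DERIV_flat[unfolded has_field_derivative_def]])
      (auto intro!: derivative_eq_intros)
  {
    case 0
    show ?case
      using D by (auto simp: continuous_on_eq_continuous_at intro: has_derivative_continuous)
  next
    case (Suc k)
    let ?e = "\<lambda>m x. flat m (v \<bullet> x + c)"
    have "frechet_derivative (?e n) (at x) b =
        ?e (n + 2) x * (v \<bullet> b) + ?e (n + 1) x * (- real n * (v \<bullet> b))" for x b
      using frechet_derivative_at[OF D, of n x, symmetric] by (simp add: algebra_simps)
    moreover have "Ck k (\<lambda>x. ?e (n + 2) x * (v \<bullet> b) + ?e (n + 1) x * (- real n * (v \<bullet> b)))" for b
      by (intro Ck_add Ck_mult Suc.IH Ck_const)
    ultimately show ?case
      using D[THEN differentiableI] unfolding Ck.simps(2) by (simp del: One_nat_def)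
  }
qed

section \<open>The fundamental lemma of the calculus of variations\<close>

lemma flat_0_scaled_tendsto: "(\<lambda>n. flat 0 (real (Suc n) * t)) \<longlonglongrightarrow> indicat_real {0<..} t"
proof (cases "t > 0")
  case True
  have "(\<lambda>n. exp (- (1 / t) * inverse (real (Suc n)))) \<longlonglongrightarrow> exp (- (1 / t) * 0)"
    by (intro tendsto_intros LIMSEQ_inverse_real_of_nat)
  moreover have "flat 0 (real (Suc n) * t) = exp (- (1 / t) * inverse (real (Suc n)))" for n
    using True by (simp add: flat_def divide_inverse del: of_nat_Suc)
  ultimately show ?thesis
    using True by simp
next
  case False
  then have "flat 0 (real (Suc n) * t) = 0" for n
    by (auto simp: flat_def zero_less_mult_iff simp del: of_nat_Suc)
  then show ?thesis
    using False by simp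
qed

text \<open>Since \<open>flat 0 (n * t) = flat 0 t powr (1 / n)\<close>, the bumps increase to the indicator of the box.\<close>

definition bump :: "'a::euclidean_space \<Rightarrow> 'a \<Rightarrow> nat \<Rightarrow> 'a \<Rightarrow> real" where
  "bump a b n x = (\<Prod>i\<in>Basis. flat 0 (real (Suc n) * (x \<bullet> i - a \<bullet> i)) * flat 0 (real (Suc n) * (b \<bullet> i - x \<bullet> i)))"

lemma bump_bounds: "0 \<le> bump a b n x" "bump a b n x \<le> 1"
  unfolding bump_def by (auto intro!: prod_nonneg prod_le_1 mult_le_one simp: flat_def)

lemma bump_outside: "x \<notin> box a b \<Longrightarrow> bump a b n x = 0"
  by (force simp: bump_def mem_box flat_def not_less zero_less_mult_iff simp del: of_nat_Suc)

lemma bump_tendsto: "(\<lambda>n. bump a b n x) \<longlonglongrightarrow> indicat_real (box a b) x"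
proof -
  have "(\<lambda>n. bump a b n x) \<longlonglongrightarrow>
      (\<Prod>i\<in>Basis. indicat_real {0<..} (x \<bullet> i - a \<bullet> i) * indicat_real {0<..} (b \<bullet> i - x \<bullet> i))"
    unfolding bump_def by (intro tendsto_intros flat_0_scaled_tendsto)
  also have "(\<Prod>i\<in>Basis. indicat_real {0<..} (x \<bullet> i - a \<bullet> i) * indicat_real {0<..} (b \<bullet> i - x \<bullet> i))
      = indicat_real (box a b) x"
    by (cases "x \<in> box a b") (auto simp: mem_box indicator_def)
  finally show ?thesis .
qed

lemma Ck_bump: "Ck k (bump a b n)"
proof -
  have 1: "Ck k (\<lambda>x. flat 0 (real (Suc n) * (x \<bullet> i - a \<bullet> i)))" for i
    using Ck_flat[of k 0 "real (Suc n) *\<^sub>R i" "- real (Suc n) * (a \<bullet> i)"]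
    by (simp add: algebra_simps inner_commute)
  have 2: "Ck k (\<lambda>x. flat 0 (real (Suc n) * (b \<bullet> i - x \<bullet> i)))" for i
    using Ck_flat[of k 0 "- real (Suc n) *\<^sub>R i" "real (Suc n) * (b \<bullet> i)"]
    by (simp add: algebra_simps inner_commute)
  show ?thesis
    unfolding bump_def[abs_def] by (intro Ck_prod Ck_mult 1 2) simp
qed

lemma bump_test_function: "cbox a b \<subseteq> U \<Longrightarrow> bump a b n \<in> test_functions U"
proof -
  assume U: "cbox a b \<subseteq> U"
  have "closure {x. bump a b n x \<noteq> 0} \<subseteq> cbox a b"
    by (rule closure_minimal) (use bump_outside box_subset_cbox in \<open>blast, auto\<close>)
  then show ?thesis
    unfolding test_functions_def using U Ck_bump
    by (auto intro: bounded_subset[OF bounded_cbox] simp: compact_eq_bounded_closed)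
qed

text \<open>The bumps of the box are test functions that tend to the indicator of the open box.
  Dominated convergence carries the vanishing integrals over to the limit, and the boundary of the
  box is null.\<close>

lemma integral_cbox_eq_0:
  fixes g :: "'a::euclidean_space \<Rightarrow> real"
  assumes "open U" "cbox a b \<subseteq> U" "locally_integrable U g"
    and "\<And>\<phi>. \<phi> \<in> test_functions U \<Longrightarrow> (\<integral>x. g x * \<phi> x \<partial>lebesgue_on U) = 0"
  shows "integral (cbox a b) g = 0"
proof -
  have g: "g absolutely_integrable_on cbox a b"
    using assms by (auto simp: locally_integrable_def)
  \<comment> \<open>Integrability of \<open>g\<close> is known on compact subsets of
    \<open>U\<close> only; cutting off at the box gives a dominating function on the whole
    space.\<close>
  define f where "f x = indicat_real (cbox a b) x *\<^sub>R g x" for x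
  have f: "integrable lebesgue f"
    using g unfolding f_def set_integrable_def .
  have meas: "bump a b n \<in> borel_measurable lebesgue" for n
    using Ck_bump[of 0 a b n]
    by (auto intro!: measurable_completion borel_measurable_continuous_onI)
  have "f x * bump a b n x = indicat_real U x *\<^sub>R (g x * bump a b n x)" for n x
    using bump_outside[of x a b n] assms(2) box_subset_cbox[of a b]
    by (auto simp: f_def indicator_def)
  then have "(\<integral>x. f x * bump a b n x \<partial>lebesgue) = (\<integral>x. g x * bump a b n x \<partial>lebesgue_on U)" for n
    using assms(1) by (subst integral_restrict_space) (auto intro!: Bochner_Integration.integral_cong)
  then have "(\<integral>x. f x * bump a b n x \<partial>lebesgue) = 0" for n
    using assms(4)[OF bump_test_function[OF assms(2)]] by simp
  moreover have "(\<lambda>n. \<integral>x. f x * bump a b n x \<partial>lebesgue) \<longlonglongrightarrow> (\<integral>x. f x * indicat_real (box a b) x \<partial>lebesgue)"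
  proof (rule integral_dominated_convergence[where w="\<lambda>x. norm (f x)"])
    show "AE x in lebesgue. (\<lambda>n. f x * bump a b n x) \<longlonglongrightarrow> f x * indicat_real (box a b) x"
      by (intro AE_I2 tendsto_intros bump_tendsto)
    show "AE x in lebesgue. norm (f x * bump a b n x) \<le> norm (f x)" for n
      using bump_bounds[of a b n] by (auto simp: abs_mult intro!: mult_left_le)
    show "(\<lambda>x. f x * indicat_real (box a b) x) \<in> borel_measurable lebesgue"
      by (intro borel_measurable_times borel_measurable_indicator borel_measurable_integrable f) auto
  qed (use f meas in auto)
  ultimately have "(\<integral>x. f x * indicat_real (box a b) x \<partial>lebesgue) = 0"
    by (simp add: LIMSEQ_const_iff)
  also have "(\<integral>x. f x * indicat_real (box a b) x \<partial>lebesgue) = (LINT x:box a b|lebesgue. g x)"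
    unfolding set_lebesgue_integral_def
    by (intro Bochner_Integration.integral_cong) (use box_subset_cbox[of a b] in \<open>auto simp: f_def indicator_def\<close>)
  also have "\<dots> = integral (box a b) g"
    by (intro set_lebesgue_integral_eq_integral(2) set_integrable_subset[OF g]) (auto simp: box_subset_cbox)
  finally show ?thesis
    by (simp add: integral_open_interval)
qed

text \<open>Once all integrals over boxes in \<open>U\<close> vanish, Lebesgue differentiation makes
  \<open>g\<close> vanish almost everywhere on each such box, and countably many of them cover
  \<open>U\<close>.\<close>

lemma weak_zero_imp_AE_zero:
  fixes g :: "'a::euclidean_space \<Rightarrow> real"
  assumes "open U" "locally_integrable U g"
    and "\<And>\<phi>. \<phi> \<in> test_functions U \<Longrightarrow> (\<integral>x. g x * \<phi> x \<partial>lebesgue_on U) = 0"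
  shows "negligible {x \<in> U. g x \<noteq> 0}"
proof -
  have *: "negligible {x \<in> cbox a b. g x \<noteq> 0}" if U: "cbox a b \<subseteq> U" for a b
  proof -
    let ?f = "\<lambda>x. if x \<in> cbox a b then g x else 0"
    have g: "g absolutely_integrable_on cbox a b"
      using assms U by (auto simp: locally_integrable_def)
    have int: "?f integrable_on cbox c d \<and> integral (cbox c d) ?f = 0" for c d
    proof -
      \<comment> \<open>Integrating the cut-off function over any box means integrating
        \<open>g\<close> over an intersection of two boxes, which is a box inside
        \<open>U\<close>.\<close>
      obtain u v where uv: "cbox a b \<inter> cbox c d = cbox u v"
        unfolding Int_interval by blast
      have "cbox u v \<subseteq> cbox a b"
        using uv by blast
      then have "g integrable_on cbox u v"
        by (rule integrable_on_subcbox[OF set_lebesgue_integral_eq_integral(1)[OF g]])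
      moreover have "integral (cbox u v) g = 0"
        using \<open>cbox u v \<subseteq> cbox a b\<close> U by (intro integral_cbox_eq_0[OF assms(1) _ assms(2,3)]) auto
      ultimately show ?thesis
        unfolding Henstock_Kurzweil_Integration.integral_restrict_Int integrable_restrict_Int uv by simp
    qed
    \<comment> \<open>Outside the null set \<open>N\<close>, the averages over small cubes with
      corner \<open>x\<close> converge to the value at \<open>x\<close>.\<close>
    obtain N where N: "negligible N"
       "\<And>x e. \<lbrakk>x \<notin> N; 0 < e\<rbrakk> \<Longrightarrow> \<exists>d>0. \<forall>h. 0 < h \<and> h < d \<longrightarrow>
          norm (integral (cbox x (x + h *\<^sub>R One)) ?f /\<^sub>R h ^ DIM('a) - ?f x) < e"
      by (rule integrable_ccontinuous_explicit[of ?f, OF int[THEN conjunct1]]) (rule that; assumption)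
    have "?f x = 0" if x: "x \<notin> N" for x
    proof (rule ccontr)
      \<comment> \<open>All averages are 0, so taking the absolute value at \<open>x\<close> as the
        tolerance yields a number smaller than itself.\<close>
      assume "?f x \<noteq> 0"
      then obtain d where "d > 0" "\<forall>h. 0 < h \<and> h < d \<longrightarrow>
          norm (integral (cbox x (x + h *\<^sub>R One)) ?f /\<^sub>R h ^ DIM('a) - ?f x) < norm (?f x)"
        using N(2)[OF x, of "norm (?f x)"] by auto
      from this(2)[rule_format, of "d / 2"] \<open>d > 0\<close> int show False
        by simp
    qed
    then show ?thesis
      by (intro negligible_subset[OF N(1)]) (auto split: if_splits, metis)
  qed
  obtain D where D: "countable D" "D \<subseteq> Pow U" "\<And>X. X \<in> D \<Longrightarrow> \<exists>a b. X = cbox a b" "\<Union>D = U"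
    using open_countable_Union_open_cbox[OF assms(1)] by metis
  have "negligible (\<Union>X\<in>D. {x \<in> X. g x \<noteq> 0})"
    using D(1-3) * by (intro negligible_countable_Union) (auto, blast)
  moreover have "(\<Union>X\<in>D. {x \<in> X. g x \<noteq> 0}) = {x \<in> U. g x \<noteq> 0}"
    using D(4) by blast
  ultimately show ?thesis by (simp only:)
qed

section \<open>Weak derivatives along directions of invariance\<close>

lemma Ck_imp_differentiable: "(\<And>k. Ck k f) \<Longrightarrow> f differentiable (at x)"
  by (metis Ck.simps(2))

text \<open>\<open>Ck\<close> speaks of derivatives along basis vectors only; linearity of the
  derivative extends continuity to an arbitrary direction.\<close>

lemma continuous_dir_deriv:
  fixes \<phi> :: "'a::euclidean_space \<Rightarrow> real"
  assumes "\<And>k. Ck k \<phi>"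
  shows "continuous_on UNIV (\<lambda>x. frechet_derivative \<phi> (at x) b)"
proof -
  have "frechet_derivative \<phi> (at x) b = (\<Sum>i\<in>Basis. (b \<bullet> i) * frechet_derivative \<phi> (at x) i)" for x
  proof -
    interpret linear "frechet_derivative \<phi> (at x)"
      using Ck_imp_differentiable[OF assms] by (rule linear_frechet_derivative)
    show ?thesis
      by (subst euclidean_representation[of b, symmetric]) (simp add: sum scaleR)
  qed
  moreover have "continuous_on UNIV (\<lambda>x. frechet_derivative \<phi> (at x) i)" if "i \<in> Basis" for i
    using assms[of "Suc 0"] that by simp
  ultimately show ?thesis
    by (auto intro!: continuous_intros)
qed

lemma dir_deriv_eq_0_outside_support:
  fixes \<phi> :: "'a::euclidean_space \<Rightarrow> real"
  assumes "x \<notin> closure {x. \<phi> x \<noteq> 0}"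
  shows "frechet_derivative \<phi> (at x) b = 0"
proof -
  have "(\<phi> has_derivative (\<lambda>_. 0)) (at x)"
    by (rule has_derivative_transform_within_open[where f="\<lambda>_. 0" and s="- closure {x. \<phi> x \<noteq> 0}"])
      (use assms closure_subset[of "{x. \<phi> x \<noteq> 0}"] in auto)
  then show ?thesis
    by (metis frechet_derivative_at)
qed

lemma continuous_compact_support_bounded:
  fixes f :: "'a::euclidean_space \<Rightarrow> real"
  assumes "continuous_on UNIV f" "compact K" "\<And>x. x \<notin> K \<Longrightarrow> f x = 0"
  shows "\<exists>M. \<forall>x. \<bar>f x\<bar> \<le> M"
proof -
  have "bounded (f ` K)"
    using assms by (intro compact_imp_bounded compact_continuous_image) (auto intro: continuous_on_subset)
  then obtain M where "\<forall>x\<in>K. \<bar>f x\<bar> \<le> M"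
    unfolding bounded_iff by auto
  then have "\<bar>f x\<bar> \<le> max M 0" for x
    using assms(3)[of x] by (cases "x \<in> K") (auto simp: le_max_iff_disj)
  then show ?thesis
    by blast
qed

lemma integrable_bounded_support:
  fixes f :: "'a::euclidean_space \<Rightarrow> real"
  assumes "f \<in> borel_measurable borel" "\<And>x. \<bar>f x\<bar> \<le> M" "\<And>x. x \<notin> cball 0 R \<Longrightarrow> f x = 0"
  shows "integrable lborel f"
proof (rule Bochner_Integration.integrable_bound)
  show "integrable lborel (\<lambda>x. M * indicat_real (cball 0 R) x)"
    by (intro integrable_mult_right integrable_real_indicator) (auto simp: emeasure_lborel_cball_finite[unfolded infinity_ennreal_def])
  show "AE x in lborel. norm (f x) \<le> norm (M * indicat_real (cball 0 R) x)"
    using assms(2,3) by (intro AE_I2) (force simp: indicator_def intro: order_trans[OF _ abs_ge_self])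
qed (use assms in auto)

lemma integral_lborel_translation:
  fixes f :: "'a::euclidean_space \<Rightarrow> real"
  assumes "f \<in> borel_measurable borel"
  shows "(\<integral>x. f (x + c) \<partial>lborel) = (\<integral>x. f x \<partial>lborel)"
proof -
  have "(\<integral>x. f x \<partial>lborel) = (\<integral>x. f x \<partial>distr lborel borel ((+) c))"
    by (simp add: lborel_distr_plus)
  also have "\<dots> = (\<integral>x. f (c + x) \<partial>lborel)"
    using assms by (intro integral_distr) auto
  finally show ?thesis
    by (simp add: add.commute)
qed

text \<open>The derivative is replaced by difference quotients along \<open>b\<close>. Against
  \<open>H\<close> these integrate to 0, since both Lebesgue measure and \<open>H\<close> are
  invariant under translation along \<open>b\<close>; dominated convergence passes to the limit. All
  differentiation falls on \<phi>, so \<open>H\<close> may jump.\<close>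

lemma integral_invariant_times_dir_deriv:
  fixes H \<phi> :: "'a::euclidean_space \<Rightarrow> real"
  assumes H: "H \<in> borel_measurable borel" "\<And>x. \<bar>H x\<bar> \<le> C" "\<And>x t. H (x + t *\<^sub>R b) = H x"
    and Ck: "\<And>k. Ck k \<phi>" and supp: "compact (closure {x. \<phi> x \<noteq> 0})"
  shows "(\<integral>x. H x * frechet_derivative \<phi> (at x) b \<partial>lborel) = 0"
proof -
  define D where "D x = frechet_derivative \<phi> (at x) b" for x
  have cont: "continuous_on UNIV \<phi>" "continuous_on UNIV D"
    using Ck[of 0] continuous_dir_deriv[OF Ck] by (auto simp: D_def)
  have meas [measurable]: "\<phi> \<in> borel_measurable borel" "D \<in> borel_measurable borel" "H \<in> borel_measurable borel"
    using cont H by (auto intro: borel_measurable_continuous_onI)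
  have C: "0 \<le> C"
    using H(2)[of 0] by simp
  let ?K = "closure {x. \<phi> x \<noteq> 0}"
  have \<phi>0: "\<phi> x = 0" if "x \<notin> ?K" for x
    using that closure_subset[of "{x. \<phi> x \<noteq> 0}"] by auto
  have D0: "D x = 0" if "x \<notin> ?K" for x
    unfolding D_def using that by (rule dir_deriv_eq_0_outside_support)
  obtain B where B: "\<And>x. \<bar>\<phi> x\<bar> \<le> B"
    using continuous_compact_support_bounded[OF cont(1) supp \<phi>0] by blast
  obtain M where M: "\<And>x. \<bar>D x\<bar> \<le> M"
    using continuous_compact_support_bounded[OF cont(2) supp D0] by blast
  obtain r where r: "?K \<subseteq> cball 0 r"
    using compact_imp_bounded[OF supp] bounded_subset_ballD[of _ 0] ball_subset_cball by (metis order_trans)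
  have deriv: "((\<lambda>s. \<phi> (x + s *\<^sub>R b)) has_real_derivative D (x + s *\<^sub>R b)) (at s)" for x s
  proof -
    have \<phi>': "(\<phi> has_derivative frechet_derivative \<phi> (at y)) (at y)" for y
      using Ck_imp_differentiable[OF Ck] by (simp add: frechet_derivative_works)
    then interpret linear "frechet_derivative \<phi> (at (x + s *\<^sub>R b))"
      by (rule has_derivative_linear)
    have "((\<lambda>s. \<phi> (x + s *\<^sub>R b)) has_derivative
        (\<lambda>h. frechet_derivative \<phi> (at (x + s *\<^sub>R b)) (h *\<^sub>R b))) (at s)"
      by (rule has_derivative_compose[OF _ \<phi>']) (auto intro!: derivative_eq_intros)
    then show ?thesis
      by (simp add: has_field_derivative_def D_def scaleR mult_commute_abs)
  qed
  \<comment> \<open>Step lengths in (0, 1] tending to 0; the bound 1 confines all translated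
    supports to one ball.\<close>
  define t where "t n = inverse (real (Suc n))" for n
  have t: "0 < t n" "t n \<le> 1" for n
    by (auto simp: t_def field_simps)
  define q where "q n x = H x * ((\<phi> (x + t n *\<^sub>R b) - \<phi> x) / t n)" for n x
  have q_meas [measurable]: "q n \<in> borel_measurable borel" for n
    unfolding q_def by measurable
  let ?R = "r + norm b"
  have far: "\<phi> x = 0" "\<phi> (x + t n *\<^sub>R b) = 0" if "x \<notin> cball 0 ?R" for x n
  proof -
    have "norm x \<le> norm (x + t n *\<^sub>R b) + norm (t n *\<^sub>R b)"
      using norm_triangle_ineq4[of "x + t n *\<^sub>R b" "t n *\<^sub>R b"] by simp
    moreover have "norm (t n *\<^sub>R b) \<le> norm b"
      using t[of n] by (simp add: mult_left_le_one_le)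
    ultimately have "norm (x + t n *\<^sub>R b) > r" "norm x > r"
      using that norm_ge_zero[of b] by (auto simp del: norm_ge_zero)
    then show "\<phi> x = 0" "\<phi> (x + t n *\<^sub>R b) = 0"
      using r by (auto intro!: \<phi>0)
  qed
  have "(\<integral>x. q n x \<partial>lborel) = 0" for n
  proof -
    \<comment> \<open>Invariance shifts the argument of \<open>H\<close> as well, and then the whole
      integrand is a translate.\<close>
    have "(\<integral>x. H x * \<phi> (x + t n *\<^sub>R b) \<partial>lborel) = (\<integral>x. H (x + t n *\<^sub>R b) * \<phi> (x + t n *\<^sub>R b) \<partial>lborel)"
      by (simp add: H(3))
    also have "\<dots> = (\<integral>x. H x * \<phi> x \<partial>lborel)"
      by (rule integral_lborel_translation) measurable
    finally have eq: "(\<integral>x. H x * \<phi> (x + t n *\<^sub>R b) \<partial>lborel) = (\<integral>x. H x * \<phi> x \<partial>lborel)" .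
    have "integrable lborel (\<lambda>x. H x * \<phi> (x + t n *\<^sub>R b))" "integrable lborel (\<lambda>x. H x * \<phi> x)"
      by (rule integrable_bounded_support[where M="C * B" and R="?R"];
        use H(2) B C far in \<open>auto simp: abs_mult intro!: mult_mono\<close>)+
    then have "(\<integral>x. (H x * \<phi> (x + t n *\<^sub>R b) - H x * \<phi> x) / t n \<partial>lborel) = 0"
      by (simp add: eq)
    then show ?thesis
      by (simp add: q_def right_diff_distrib)
  qed
  moreover have "(\<lambda>n. \<integral>x. q n x \<partial>lborel) \<longlonglongrightarrow> (\<integral>x. H x * D x \<partial>lborel)"
  proof (rule integral_dominated_convergence[where w="\<lambda>x. C * M * indicat_real (cball 0 ?R) x"])
    show "integrable lborel (\<lambda>x. C * M * indicat_real (cball 0 ?R) x)"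
      by (intro integrable_mult_right integrable_real_indicator) (auto simp: emeasure_lborel_cball_finite[unfolded infinity_ennreal_def])
    have "(\<lambda>n. (\<phi> (x + t n *\<^sub>R b) - \<phi> x) / t n) \<longlonglongrightarrow> D x" for x
    proof -
      have "((\<lambda>h. (\<phi> (x + h *\<^sub>R b) - \<phi> x) / h) \<longlongrightarrow> D x) (at 0)"
        using deriv[of x 0] by (simp add: DERIV_def)
      moreover have "filterlim t (at 0) sequentially"
        unfolding t_def filterlim_at using LIMSEQ_inverse_real_of_nat by auto
      ultimately show ?thesis
        by (rule filterlim_compose)
    qed
    then show "AE x in lborel. (\<lambda>n. q n x) \<longlonglongrightarrow> H x * D x"
      unfolding q_def by (intro AE_I2 tendsto_intros)
    \<comment> \<open>The mean value theorem on the segment from \<open>x\<close> to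
      \<open>x + t n *\<^sub>R b\<close> gives a bound uniform in \<open>n\<close>, as domination
      requires.\<close>
    have "\<bar>(\<phi> (x + t n *\<^sub>R b) - \<phi> x) / t n\<bar> \<le> M" for x n
    proof -
      obtain z where "\<phi> (x + t n *\<^sub>R b) - \<phi> (x + 0 *\<^sub>R b) = (t n - 0) * D (x + z *\<^sub>R b)"
        using MVT2[OF t(1)[of n], of "\<lambda>s. \<phi> (x + s *\<^sub>R b)" "\<lambda>s. D (x + s *\<^sub>R b)"] deriv by blast
      then show ?thesis
        using M t(1)[of n] by simp
    qed
    then have "\<bar>q n x\<bar> \<le> C * M" for n x
      unfolding q_def abs_mult using H(2)[of x] C by (intro mult_mono) auto
    moreover have "q n x = 0" if "x \<notin> cball 0 ?R" for n x
      using far[OF that] by (simp add: q_def)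
    ultimately show "AE x in lborel. norm (q n x) \<le> C * M * indicat_real (cball 0 ?R) x" for n
      by (intro AE_I2) (auto simp: indicator_def)
  qed measurable
  ultimately show ?thesis
    by (simp add: LIMSEQ_const_iff D_def)
qed

section \<open>Changes on null sets, and vanishing weak derivatives\<close>

lemma AE_lebesgue_onI:
  assumes "S \<in> sets lebesgue" "negligible N" "\<And>x. x \<in> S - N \<Longrightarrow> P x"
  shows "AE x in lebesgue_on S. P x"
proof -
  have "AE x in lebesgue. x \<in> S \<longrightarrow> P x"
    by (rule AE_I'[of N]) (use assms in \<open>auto simp: negligible_iff_null_sets\<close>)
  then show ?thesis
    using assms(1) by (subst AE_restrict_space_iff) auto
qed

text \<open>Filling \<open>f\<close> up with \<open>G\<close> outside \<open>S\<close> gives a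
  function that differs from the Borel function \<open>G\<close> only within \<open>N\<close>;
  Lebesgue measure is complete.\<close>

lemma borel_measurable_lebesgue_on_spike:
  fixes f G :: "'a::euclidean_space \<Rightarrow> real"
  assumes "G \<in> borel_measurable borel" "negligible N" "\<And>x. x \<in> S - N \<Longrightarrow> f x = G x"
  shows "f \<in> borel_measurable (lebesgue_on S)"
proof -
  let ?f = "\<lambda>x. if x \<in> S then f x else G x"
  have "G \<in> borel_measurable lebesgue"
    using assms(1) by (auto intro: measurable_completion)
  moreover have "AE x in lebesgue. G x = ?f x"
    by (rule AE_I'[of N]) (use assms in \<open>auto simp: negligible_iff_null_sets, metis\<close>)
  ultimately have "?f \<in> borel_measurable lebesgue"
    by (rule borel_measurable_AE)
  then have "?f \<in> borel_measurable (lebesgue_on S)"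
    by (rule measurable_restrict_space1)
  then show ?thesis
    by (subst measurable_cong[where g = ?f]) auto
qed

text \<open>The invariant function \<open>H\<close> lives on the whole space, so that it can be
  translated freely, while \<open>v\<close> is only compared with it on \<open>U\<close>. The
  supports of the test functions lie in \<open>U\<close>, so integrals over \<open>U\<close> extend
  to the whole space.\<close>

lemma has_weak_dir_deriv_zero:
  fixes v H :: "'a::euclidean_space \<Rightarrow> real"
  assumes U: "open U"
    and H: "H \<in> borel_measurable borel" "\<And>x. \<bar>H x\<bar> \<le> C" "\<And>x t. H (x + t *\<^sub>R b) = H x"
    and N: "negligible N" "\<And>x. x \<in> U - N \<Longrightarrow> v x = H x"
  shows "has_weak_dir_deriv U b v (\<lambda>_. 0)"
  unfolding has_weak_dir_deriv_def
proof (intro conjI ballI)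
  show "locally_integrable U v"
    unfolding locally_integrable_def
  proof (intro allI impI)
    fix K assume K: "compact K \<and> K \<subseteq> U"
    have "H absolutely_integrable_on K"
    proof (rule measurable_bounded_by_integrable_imp_absolutely_integrable[where g="\<lambda>_. C"])
      show "H \<in> borel_measurable (lebesgue_on K)"
        by (rule borel_measurable_lebesgue_on_spike[OF H(1) N(1)]) simp
      show "(\<lambda>_. C) integrable_on K"
        using K by (intro integrable_on_const lmeasurable_compact) auto
    qed (use K H in \<open>auto intro: lmeasurable_compact fmeasurableD\<close>)
    then show "v absolutely_integrable_on K"
      by (rule absolutely_integrable_spike[OF _ N(1)]) (use N K in auto)
  qed
  show "locally_integrable U (\<lambda>_. 0)"
    by (simp add: locally_integrable_def)
  fix \<phi> assume \<phi>: "\<phi> \<in> test_functions U"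
  let ?D = "\<lambda>x. frechet_derivative \<phi> (at x) b"
  have D: "?D \<in> borel_measurable borel"
    using \<phi> by (auto simp: test_functions_def intro!: borel_measurable_continuous_onI continuous_dir_deriv)
  have D0: "?D x = 0" if "x \<notin> U" for x
    using \<phi> that by (auto simp: test_functions_def intro!: dir_deriv_eq_0_outside_support)
  have "(\<integral>x. v x * ?D x \<partial>lebesgue_on U) = (\<integral>x. H x * ?D x \<partial>lebesgue_on U)"
  proof (rule integral_cong_AE)
    show "(\<lambda>x. v x * ?D x) \<in> borel_measurable (lebesgue_on U)"
      by (rule borel_measurable_lebesgue_on_spike[OF borel_measurable_times[OF H(1) D] N(1)]) (simp add: N(2))
    show "(\<lambda>x. H x * ?D x) \<in> borel_measurable (lebesgue_on U)"
      by (rule borel_measurable_lebesgue_on_spike[OF borel_measurable_times[OF H(1) D] N(1)]) simp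
    show "AE x in lebesgue_on U. v x * ?D x = H x * ?D x"
      by (rule AE_lebesgue_onI[OF _ N(1)]) (use U N in auto)
  qed
  also have "\<dots> = (\<integral>x. indicat_real U x *\<^sub>R (H x * ?D x) \<partial>lebesgue)"
    using U by (intro integral_restrict_space) auto
  also have "\<dots> = (\<integral>x. H x * ?D x \<partial>lebesgue)"
    by (intro Bochner_Integration.integral_cong) (auto simp: indicator_def D0)
  also have "\<dots> = (\<integral>x. H x * ?D x \<partial>lborel)"
    using H D by (intro integral_completion) auto
  also have "\<dots> = 0"
    using \<phi> by (intro integral_invariant_times_dir_deriv[OF H]) (auto simp: test_functions_def)
  finally show "(\<integral>x. v x * ?D x \<partial>lebesgue_on U) = - (\<integral>x. 0 * \<phi> x \<partial>lebesgue_on U)"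
    by simp
qed

text \<open>Both weak identities have the same left-hand side, so \<open>g\<close> integrates to 0
  against every test function.\<close>

lemma has_weak_dir_deriv_zero_unique:
  assumes "open U" "has_weak_dir_deriv U b v (\<lambda>_. 0)" "has_weak_dir_deriv U b v g"
  shows "negligible {x \<in> U. g x \<noteq> 0}"
  using assms by (intro weak_zero_imp_AE_zero) (auto simp: has_weak_dir_deriv_def)

section \<open>The geometry of the domain\<close>

lemma measure_subset_shear:
  fixes A :: "real^2^2"
  assumes "S \<subseteq> (\<lambda>x. A *v x) ` cbox a b" "\<bar>det A\<bar> = 1" "S \<in> sets lebesgue"
  shows "measure lebesgue S \<le> measure lborel (cbox a b)"
proof -
  have "compact ((\<lambda>x. A *v x) ` cbox a b)"
    by (intro compact_continuous_image linear_continuous_on) (auto simp: linear_linear)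
  then have "measure lebesgue S \<le> measure lebesgue ((\<lambda>x. A *v x) ` cbox a b)"
    using assms by (intro measure_mono_fmeasurable lmeasurable_compact)
  also have "\<dots> = measure lebesgue (cbox a b)"
    using assms(2) by (subst measure_lebesgue_linear_transformation) auto
  finally show ?thesis by simp
qed

lemma inner_real_2: "x \<bullet> y = x $ 1 * y $ 1 + x $ 2 * y $ 2" for x y :: "real^2"
  by (simp add: inner_vec_def sum_2)

lemma inner_\<xi>: "\<xi>\<^sub>1 \<bullet> x = x $ 1 + (sqrt 2 - 1) * x $ 2" "\<xi>\<^sub>2 \<bullet> x = (sqrt 2 - 1) * x $ 1 + x $ 2"
  by (simp_all add: inner_real_2 \<xi>\<^sub>1_def \<xi>\<^sub>2_def)

lemma open_\<Omega>: "open \<Omega>"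
  unfolding \<Omega>_def by (intro open_Collect_conj open_Collect_less continuous_intros)

lemma bounded_\<Omega>: "bounded \<Omega>"
  by (rule bounded_subset[of "cbox 0 1"]) (auto simp: \<Omega>_def mem_box_cart forall_2)

lemma diameter_\<Omega>: "1 \<le> diameter \<Omega>"
proof -
  \<comment> \<open>The domain is open, so two points inside it are taken; their distance is 0.8 *
    sqrt 2 > 1.\<close>
  let ?x = "vector [1/10, 1/10] :: real^2" and ?y = "vector [9/10, 9/10] :: real^2"
  have "1 \<le> dist ?x ?y"
    by (simp add: dist_norm norm_eq_sqrt_inner inner_real_2 power2_eq_square)
  also have "\<dots> \<le> diameter \<Omega>"
    by (rule diameter_bounded_bound[OF bounded_\<Omega>]) (auto simp: \<Omega>_def)
  finally show ?thesis .
qed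

definition strip :: "real^2 \<Rightarrow> real \<Rightarrow> (real^2) set" where
  "strip \<xi> r = {x \<in> \<Omega>. \<bar>\<xi> \<bullet> x - lev\<bar> < r}"

lemma open_strip: "open (strip \<xi> r)"
proof -
  have "strip \<xi> r = \<Omega> \<inter> {x. \<bar>\<xi> \<bullet> x - lev\<bar> < r}"
    by (auto simp: strip_def)
  then show ?thesis
    by (auto intro!: open_Int open_\<Omega> open_Collect_less continuous_intros)
qed

lemma lmeasurable_strip: "strip \<xi> r \<in> lmeasurable"
  by (rule lmeasurable_open[OF bounded_subset[OF bounded_\<Omega>] open_strip]) (auto simp: strip_def)

lemma measure_strip:
  assumes "\<xi> \<in> {\<xi>\<^sub>1, \<xi>\<^sub>2}" "r > 0"
  shows "measure lebesgue (strip \<xi> r) \<le> 2 * r"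
proof -
  have S: "strip \<xi> r \<in> sets lebesgue"
    using open_strip by auto
  have c: "measure lborel (cbox a b) = (b $ 1 - a $ 1) * (b $ 2 - a $ 2)" if "a $ 1 \<le> b $ 1" "a $ 2 \<le> b $ 2"
    for a b :: "real^2"
    using that by (subst content_cbox_cart)
      (auto simp: UNIV_2 interval_ne_empty_cart forall_2)
  have "\<xi> = \<xi>\<^sub>1 \<or> \<xi> = \<xi>\<^sub>2" using assms by auto
  then show ?thesis
  proof
    assume \<xi>: "\<xi> = \<xi>\<^sub>1"
    \<comment> \<open>The inverse of the change to the coordinates
      \<open>\<xi>\<^sub>1 \<bullet> x\<close> and \<open>x $ 2\<close>, in which the strip lies in
      a box with sides \<open>2 * r\<close> and 1.\<close>
    let ?A = "vector [vector [1, 1 - sqrt 2], vector [0, 1]] :: real^2^2"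
    have "strip \<xi> r \<subseteq> (\<lambda>x. ?A *v x) ` cbox (vector [lev - r, 0]) (vector [lev + r, 1])"
    proof
      fix x assume "x \<in> strip \<xi> r"
      then show "x \<in> (\<lambda>x. ?A *v x) ` cbox (vector [lev - r, 0]) (vector [lev + r, 1])"
        by (intro image_eqI[of _ _ "vector [\<xi> \<bullet> x, x $ 2]"])
          (auto simp: strip_def \<Omega>_def \<xi> inner_\<xi> mem_box_cart forall_2 vec_eq_iff
            matrix_vector_mult_def sum_2 algebra_simps)
    qed
    from measure_subset_shear[OF this _ S] show ?thesis
      using assms by (simp add: c det_2)
  next
    assume \<xi>: "\<xi> = \<xi>\<^sub>2"
    \<comment> \<open>Likewise for the coordinates \<open>x $ 1\<close> and
      \<open>\<xi>\<^sub>2 \<bullet> x\<close>.\<close>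
    let ?A = "vector [vector [1, 0], vector [1 - sqrt 2, 1]] :: real^2^2"
    have "strip \<xi> r \<subseteq> (\<lambda>x. ?A *v x) ` cbox (vector [0, lev - r]) (vector [1, lev + r])"
    proof
      fix x assume "x \<in> strip \<xi> r"
      then show "x \<in> (\<lambda>x. ?A *v x) ` cbox (vector [0, lev - r]) (vector [1, lev + r])"
        by (intro image_eqI[of _ _ "vector [x $ 1, \<xi> \<bullet> x]"])
          (auto simp: strip_def \<Omega>_def \<xi> inner_\<xi> mem_box_cart forall_2 vec_eq_iff
            matrix_vector_mult_def sum_2 algebra_simps)
    qed
    from measure_subset_shear[OF this _ S] show ?thesis
      using assms by (simp add: c det_2)
  qed
qed

section \<open>The interface and its ReLU approximation\<close>

lemma relu_difference:
  assumes "\<epsilon> > 0"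
  shows "relu (s + \<epsilon>) - relu (s - \<epsilon>) = (if s \<le> - \<epsilon> then 0 else if s < \<epsilon> then s + \<epsilon> else 2 * \<epsilon>)"
  using assms by (auto simp: relu_def)

lemma ramp_eq:
  assumes "\<epsilon> > 0"
  shows "ramp \<alpha>\<^sub>1 \<alpha>\<^sub>2 \<epsilon> \<xi> x = \<alpha>\<^sub>1 + (\<alpha>\<^sub>2 - \<alpha>\<^sub>1) / (2 * \<epsilon>) *
    (let s = \<xi> \<bullet> x - lev in if s \<le> - \<epsilon> then 0 else if s < \<epsilon> then s + \<epsilon> else 2 * \<epsilon>)"
  unfolding ramp_def Let_def relu_difference[OF assms, symmetric] by (simp add: algebra_simps)

lemma ramp_mono:
  assumes "\<alpha>\<^sub>1 < \<alpha>\<^sub>2" "\<epsilon> > 0" "\<xi> \<bullet> x \<le> \<eta> \<bullet> x"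
  shows "ramp \<alpha>\<^sub>1 \<alpha>\<^sub>2 \<epsilon> \<xi> x \<le> ramp \<alpha>\<^sub>1 \<alpha>\<^sub>2 \<epsilon> \<eta> x"
  unfolding ramp_eq[OF assms(2)] Let_def using assms
  by (intro add_left_mono mult_left_mono) auto

lemma ramp_bounds:
  assumes "\<alpha>\<^sub>1 < \<alpha>\<^sub>2" "\<epsilon> > 0"
  shows "\<alpha>\<^sub>1 \<le> ramp \<alpha>\<^sub>1 \<alpha>\<^sub>2 \<epsilon> \<xi> x" "ramp \<alpha>\<^sub>1 \<alpha>\<^sub>2 \<epsilon> \<xi> x \<le> \<alpha>\<^sub>2"
proof -
  show "\<alpha>\<^sub>1 \<le> ramp \<alpha>\<^sub>1 \<alpha>\<^sub>2 \<epsilon> \<xi> x"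
    using assms by (simp add: ramp_eq Let_def)
  have "(\<alpha>\<^sub>2 - \<alpha>\<^sub>1) / (2 * \<epsilon>) * (let s = \<xi> \<bullet> x - lev in
      if s \<le> - \<epsilon> then 0 else if s < \<epsilon> then s + \<epsilon> else 2 * \<epsilon>) \<le> (\<alpha>\<^sub>2 - \<alpha>\<^sub>1) / (2 * \<epsilon>) * (2 * \<epsilon>)"
    using assms by (intro mult_left_mono) (auto simp: Let_def)
  then show "ramp \<alpha>\<^sub>1 \<alpha>\<^sub>2 \<epsilon> \<xi> x \<le> \<alpha>\<^sub>2"
    using assms by (simp add: ramp_eq)
qed

lemma borel_measurable_ramp: "ramp \<alpha>\<^sub>1 \<alpha>\<^sub>2 \<epsilon> \<xi> \<in> borel_measurable borel"
  unfolding ramp_def[abs_def] relu_def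
  by (intro borel_measurable_continuous_onI continuous_intros)

text \<open>Extends the values of \<chi> in one region to the whole plane as a function of
  \<open>\<xi> \<bullet> x\<close> alone, which makes it invariant along the lines orthogonal to
  \<open>\<xi>\<close>.\<close>

definition step :: "real \<Rightarrow> real \<Rightarrow> real^2 \<Rightarrow> real^2 \<Rightarrow> real" where
  "step \<alpha>\<^sub>1 \<alpha>\<^sub>2 \<xi> x = (if \<xi> \<bullet> x < lev then \<alpha>\<^sub>1 else \<alpha>\<^sub>2)"

lemma borel_measurable_step: "step \<alpha>\<^sub>1 \<alpha>\<^sub>2 \<xi> \<in> borel_measurable borel"
  unfolding step_def[abs_def] by measurable

text \<open>A majorant with two levels stands in for the exact integral, so that only areas of
  strips are needed: the coefficients 1 and 3 add up to (1/2)^2 * 16 in the inner strip and leave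
  (1/4)^2 * 16 in the rest of the outer one.\<close>

lemma step_minus_ramp_bound:
  assumes "\<alpha>\<^sub>1 < \<alpha>\<^sub>2" "\<epsilon> > 0" "x \<in> \<Omega>"
  shows "(step \<alpha>\<^sub>1 \<alpha>\<^sub>2 \<xi> x - ramp \<alpha>\<^sub>1 \<alpha>\<^sub>2 \<epsilon> \<xi> x)\<^sup>2 \<le>
    (\<alpha>\<^sub>2 - \<alpha>\<^sub>1)\<^sup>2 / 16 * (indicator (strip \<xi> \<epsilon>) x + 3 * indicator (strip \<xi> (\<epsilon> / 2)) x)"
proof -
  define s where "s = \<xi> \<bullet> x - lev"
  define d where "d = \<alpha>\<^sub>2 - \<alpha>\<^sub>1"
  have d: "d > 0" using assms by (simp add: d_def)
  have ind: "indicat_real (strip \<xi> r) x = (if \<bar>s\<bar> < r then 1 else 0)" for r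
    using assms(3) by (simp add: strip_def s_def)
  \<comment> \<open>With the slope \<open>k\<close> as unit, both the jump and the ramp are
    multiples of \<open>k\<close>, and the error is a triangle of height
    \<open>k * \<epsilon>\<close> over the strip.\<close>
  define k where "k = d / (2 * \<epsilon>)"
  have k: "k > 0" "\<alpha>\<^sub>2 = \<alpha>\<^sub>1 + k * (2 * \<epsilon>)"
    using d assms(2) by (auto simp: k_def d_def)
  have "step \<alpha>\<^sub>1 \<alpha>\<^sub>2 \<xi> x - ramp \<alpha>\<^sub>1 \<alpha>\<^sub>2 \<epsilon> \<xi> x =
      k * (if \<bar>s\<bar> < \<epsilon> then (if s < 0 then - (s + \<epsilon>) else \<epsilon> - s) else 0)"
    unfolding ramp_eq[OF assms(2)] Let_def step_def s_def[symmetric] d_def[symmetric] k_def[symmetric]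
    using assms(2) by (auto simp: s_def k(2) algebra_simps)
  then have eq: "\<bar>step \<alpha>\<^sub>1 \<alpha>\<^sub>2 \<xi> x - ramp \<alpha>\<^sub>1 \<alpha>\<^sub>2 \<epsilon> \<xi> x\<bar> = (if \<bar>s\<bar> < \<epsilon> then d / (2 * \<epsilon>) * (\<epsilon> - \<bar>s\<bar>) else 0)"
    using k(1) by (auto simp: abs_mult k_def[symmetric])
  consider "\<bar>s\<bar> < \<epsilon> / 2" | "\<epsilon> / 2 \<le> \<bar>s\<bar>" "\<bar>s\<bar> < \<epsilon>" | "\<epsilon> \<le> \<bar>s\<bar>"
    by linarith
  then show ?thesis
  proof cases
    case 1
    have "d / (2 * \<epsilon>) * (\<epsilon> - \<bar>s\<bar>) \<le> d / (2 * \<epsilon>) * \<epsilon>"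
      using d assms(2) by (intro mult_left_mono) auto
    then have "\<bar>step \<alpha>\<^sub>1 \<alpha>\<^sub>2 \<xi> x - ramp \<alpha>\<^sub>1 \<alpha>\<^sub>2 \<epsilon> \<xi> x\<bar> \<le> \<bar>d / 2\<bar>"
      using 1 assms(2) d unfolding eq by simp
    then have "(step \<alpha>\<^sub>1 \<alpha>\<^sub>2 \<xi> x - ramp \<alpha>\<^sub>1 \<alpha>\<^sub>2 \<epsilon> \<xi> x)\<^sup>2 \<le> (d / 2)\<^sup>2"
      unfolding abs_le_square_iff .
    then show ?thesis
      using 1 assms(2) by (simp add: ind d_def power_divide)
  next
    case 2
    have "d / (2 * \<epsilon>) * (\<epsilon> - \<bar>s\<bar>) \<le> d / (2 * \<epsilon>) * (\<epsilon> / 2)"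
      using d assms(2) 2 by (intro mult_left_mono) auto
    then have "\<bar>step \<alpha>\<^sub>1 \<alpha>\<^sub>2 \<xi> x - ramp \<alpha>\<^sub>1 \<alpha>\<^sub>2 \<epsilon> \<xi> x\<bar> \<le> \<bar>d / 4\<bar>"
      using 2 assms(2) d unfolding eq by simp
    then have "(step \<alpha>\<^sub>1 \<alpha>\<^sub>2 \<xi> x - ramp \<alpha>\<^sub>1 \<alpha>\<^sub>2 \<epsilon> \<xi> x)\<^sup>2 \<le> (d / 4)\<^sup>2"
      unfolding abs_le_square_iff .
    then show ?thesis
      using 2 assms(2) by (simp add: ind d_def power_divide)
  next
    case 3
    then show ?thesis
      using eq by (auto simp: ind)
  qed
qed

section \<open>Identification of \<chi> and \<open>p\<close> in each region\<close>

lemma inner_\<xi>_less: "\<xi>\<^sub>2 \<bullet> x < \<xi>\<^sub>1 \<bullet> x \<longleftrightarrow> x $ 2 < x $ 1"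
proof -
  have "\<xi>\<^sub>1 \<bullet> x - \<xi>\<^sub>2 \<bullet> x = (2 - sqrt 2) * (x $ 1 - x $ 2)"
    by (simp add: inner_\<xi> algebra_simps)
  moreover have "sqrt 2 < 2"
    by (simp add: real_less_lsqrt)
  ultimately show ?thesis
    by (smt (verit) zero_less_mult_iff)
qed

lemma inner_direction:
  "\<xi>\<^sub>1 \<bullet> vector [1 - sqrt 2, 1] = 0" "\<xi>\<^sub>2 \<bullet> vector [-1, sqrt 2 - 1] = 0"
  by (simp_all add: inner_\<xi>)

text \<open>The values of \<open>X\<close> on these lines may be unconstrained. The level
  \<open>lev\<close> is nonzero, which excludes equations satisfied by every point.\<close>

lemma negligible_level: "negligible ({x. \<xi>\<^sub>1 \<bullet> x = lev} \<union> {x. \<xi>\<^sub>2 \<bullet> x = lev})"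
  by (intro negligible_Un negligible_hyperplane) (auto simp: lev_def)

text \<open>In each region the product bounded by the definition of \<open>\<Omega>\<^sub>1\<close>
  is the larger one, so both are bounded; the bounds with \<le> define a closed set.\<close>

lemma closure_\<Omega>\<^sub>1: "closure \<Omega>\<^sub>1 \<subseteq> {x. \<xi>\<^sub>1 \<bullet> x \<le> lev \<and> \<xi>\<^sub>2 \<bullet> x \<le> lev}"
proof (rule closure_minimal)
  show "closed {x. \<xi>\<^sub>1 \<bullet> x \<le> lev \<and> \<xi>\<^sub>2 \<bullet> x \<le> lev}"
    by (intro closed_Collect_conj closed_Collect_le continuous_intros)
  show "\<Omega>\<^sub>1 \<subseteq> {x. \<xi>\<^sub>1 \<bullet> x \<le> lev \<and> \<xi>\<^sub>2 \<bullet> x \<le> lev}"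
    using inner_\<xi>_less by (auto simp: \<Omega>\<^sub>1_def \<Upsilon>\<^sub>1_def \<Upsilon>\<^sub>2_def) (smt (verit))+
qed

text \<open>Decided by coordinates rather than by membership in a region, so that the formula for
  \<open>p\<close> holds on the whole plane.\<close>

definition region_normal :: "real^2 \<Rightarrow> real^2" where
  "region_normal x = (if x $ 2 < x $ 1 then \<xi>\<^sub>1 else \<xi>\<^sub>2)"

text \<open>Off the two lines each point of \<Omega> lies in \<open>\<Omega>\<^sub>1\<close> or
  \<open>\<Omega>\<^sub>2\<close>: a product above \<open>lev\<close> keeps it out of the closure of
  \<open>\<Omega>\<^sub>1\<close>.\<close>

lemma X_eq_step:
  assumes "\<And>x. x \<in> \<Omega>\<^sub>1 \<Longrightarrow> X x = \<alpha>\<^sub>1" "\<And>x. x \<in> \<Omega>\<^sub>2 \<Longrightarrow> X x = \<alpha>\<^sub>2"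
    and x: "x \<in> \<Omega>" "\<xi>\<^sub>1 \<bullet> x \<noteq> lev" "\<xi>\<^sub>2 \<bullet> x \<noteq> lev"
  shows "X x = step \<alpha>\<^sub>1 \<alpha>\<^sub>2 (region_normal x) x"
proof (cases "region_normal x \<bullet> x < lev")
  case True
  then have "x \<in> \<Omega>\<^sub>1"
    using x by (auto simp: region_normal_def \<Omega>\<^sub>1_def \<Upsilon>\<^sub>1_def \<Upsilon>\<^sub>2_def split: if_splits)
  then show ?thesis
    using True assms(1) by (simp add: step_def)
next
  case False
  then have "x \<notin> closure \<Omega>\<^sub>1"
    using x closure_\<Omega>\<^sub>1 by (auto simp: region_normal_def split: if_splits)
  then show ?thesis
    using False x assms(2) by (simp add: step_def \<Omega>\<^sub>2_def)
qed

lemma p_eq_ramp: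
  assumes "\<alpha>\<^sub>1 < \<alpha>\<^sub>2" "\<epsilon> > 0"
  shows "p \<alpha>\<^sub>1 \<alpha>\<^sub>2 \<epsilon> x = ramp \<alpha>\<^sub>1 \<alpha>\<^sub>2 \<epsilon> (region_normal x) x"
  using ramp_mono[OF assms, of \<xi>\<^sub>1 x \<xi>\<^sub>2] ramp_mono[OF assms, of \<xi>\<^sub>2 x \<xi>\<^sub>1] inner_\<xi>_less[of x]
  by (auto simp: p_def region_normal_def max_def)

lemma open_\<Upsilon>\<^sub>1: "open \<Upsilon>\<^sub>1"
proof -
  have "open (\<Omega> \<inter> {x. x $ 2 < x $ 1})"
    by (intro open_Int open_\<Omega> open_Collect_less continuous_intros)
  then show ?thesis
    by (simp add: \<Upsilon>\<^sub>1_def Collect_conj_eq)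
qed

text \<open>The interiors miss at most the diagonal, where piecewise weak derivatives are
  unconstrained.\<close>

lemma negligible_off_interiors: "negligible (\<Omega> - (interior \<Upsilon>\<^sub>1 \<union> interior \<Upsilon>\<^sub>2))"
proof (rule negligible_subset)
  let ?n = "vector [1, -1] :: real^2"
  have "?n \<noteq> 0"
    by (metis vector_2(1) zero_index zero_neq_one)
  then show "negligible {x. ?n \<bullet> x = 0}"
    by (intro negligible_hyperplane) auto
  have "open (\<Omega> \<inter> {x. x $ 1 < x $ 2})"
    by (intro open_Int open_\<Omega> open_Collect_less continuous_intros)
  then have 2: "\<Omega> \<inter> {x. x $ 1 < x $ 2} \<subseteq> interior \<Upsilon>\<^sub>2"
    by (intro interior_maximal) (auto simp: \<Upsilon>\<^sub>2_def)
  have 1: "\<Omega> \<inter> {x. x $ 2 < x $ 1} \<subseteq> interior \<Upsilon>\<^sub>1"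
    unfolding interior_open[OF open_\<Upsilon>\<^sub>1] by (auto simp: \<Upsilon>\<^sub>1_def)
  show "\<Omega> - (interior \<Upsilon>\<^sub>1 \<union> interior \<Upsilon>\<^sub>2) \<subseteq> {x. ?n \<bullet> x = 0}"
  proof
    fix x assume "x \<in> \<Omega> - (interior \<Upsilon>\<^sub>1 \<union> interior \<Upsilon>\<^sub>2)"
    then have "\<not> x $ 1 < x $ 2" "\<not> x $ 2 < x $ 1"
      using 1 2 by auto
    then show "x \<in> {x. ?n \<bullet> x = 0}"
      by (simp add: inner_real_2)
  qed
qed

section \<open>Piecewise weak derivatives along \<beta>\<close>

text \<open>The value of \<beta> in each region is orthogonal to the normal there, so a function of
  that one inner product is invariant along \<beta>.\<close>

lemma piecewise_weak_deriv_zero: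
  fixes v H\<^sub>1 H\<^sub>2 :: "real^2 \<Rightarrow> real"
  assumes N: "negligible N"
    and H\<^sub>1: "H\<^sub>1 \<in> borel_measurable borel" "\<And>x. \<bar>H\<^sub>1 x\<bar> \<le> C" "\<And>x y. \<xi>\<^sub>1 \<bullet> x = \<xi>\<^sub>1 \<bullet> y \<Longrightarrow> H\<^sub>1 x = H\<^sub>1 y"
    and H\<^sub>2: "H\<^sub>2 \<in> borel_measurable borel" "\<And>x. \<bar>H\<^sub>2 x\<bar> \<le> C" "\<And>x y. \<xi>\<^sub>2 \<bullet> x = \<xi>\<^sub>2 \<bullet> y \<Longrightarrow> H\<^sub>2 x = H\<^sub>2 y"
    and v: "\<And>x. x \<in> \<Upsilon>\<^sub>1 - N \<Longrightarrow> v x = H\<^sub>1 x" "\<And>x. x \<in> \<Upsilon>\<^sub>2 - N \<Longrightarrow> v x = H\<^sub>2 x"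
  shows "has_piecewise_weak_deriv {\<Upsilon>\<^sub>1, \<Upsilon>\<^sub>2} \<beta> v (\<lambda>_. 0)"
proof -
  have "has_weak_dir_deriv (interior \<Upsilon>\<^sub>1) (vector [1 - sqrt 2, 1]) v (\<lambda>_. 0)"
    using interior_subset[of \<Upsilon>\<^sub>1]
    by (intro has_weak_dir_deriv_zero[OF _ H\<^sub>1(1,2) H\<^sub>1(3) N] v)
      (auto simp: inner_add_right inner_direction)
  moreover have "has_weak_dir_deriv (interior \<Upsilon>\<^sub>2) (vector [-1, sqrt 2 - 1]) v (\<lambda>_. 0)"
    using interior_subset[of \<Upsilon>\<^sub>2]
    by (intro has_weak_dir_deriv_zero[OF _ H\<^sub>2(1,2) H\<^sub>2(3) N] v)
      (auto simp: inner_add_right inner_direction)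
  moreover have "\<forall>x\<in>\<Upsilon>\<^sub>1. \<beta> x = vector [1 - sqrt 2, 1]"
    by (simp add: \<beta>_def)
  moreover have "\<forall>x\<in>\<Upsilon>\<^sub>2. \<beta> x = vector [-1, sqrt 2 - 1]"
    by (simp add: \<beta>_def \<Upsilon>\<^sub>1_def \<Upsilon>\<^sub>2_def)
  ultimately show ?thesis
    unfolding has_piecewise_weak_deriv_def by blast
qed

lemma piecewise_weak_deriv_zero_unique:
  assumes "has_piecewise_weak_deriv {\<Upsilon>\<^sub>1, \<Upsilon>\<^sub>2} \<beta> v (\<lambda>_. 0)"
    and "has_piecewise_weak_deriv {\<Upsilon>\<^sub>1, \<Upsilon>\<^sub>2} \<beta> v g"
  shows "negligible {x \<in> \<Omega>. g x \<noteq> 0}"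
proof -
  have *: "negligible {x \<in> interior U. g x \<noteq> 0}" if U: "U \<in> {\<Upsilon>\<^sub>1, \<Upsilon>\<^sub>2}" for U
  \<comment> \<open>A point of \<open>U\<close> forces the two witnesses for the constant value of
    \<beta> to coincide; an empty \<open>U\<close> leaves nothing to show.\<close>
  proof (cases "U = {}")
    case False
    obtain b where b: "\<forall>x\<in>U. \<beta> x = b" "has_weak_dir_deriv (interior U) b v (\<lambda>_. 0)"
      using assms(1)[unfolded has_piecewise_weak_deriv_def, THEN bspec, OF U] by (elim exE conjE)
    obtain c where c: "\<forall>x\<in>U. \<beta> x = c" "has_weak_dir_deriv (interior U) c v g"
      using assms(2)[unfolded has_piecewise_weak_deriv_def, THEN bspec, OF U] by (elim exE conjE)
    have "c = b"
      using b(1) c(1) False by auto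
    with c(2) show ?thesis
      by (intro has_weak_dir_deriv_zero_unique[OF open_interior b(2)]) simp
  qed simp
  have "negligible ((\<Omega> - (interior \<Upsilon>\<^sub>1 \<union> interior \<Upsilon>\<^sub>2)) \<union>
      ({x \<in> interior \<Upsilon>\<^sub>1. g x \<noteq> 0} \<union> {x \<in> interior \<Upsilon>\<^sub>2. g x \<noteq> 0}))"
    by (intro negligible_Un negligible_off_interiors *) simp_all
  then show ?thesis
    by (rule negligible_subset) blast
qed

text \<open>Membership accompanies the norm because \<open>L2norm\<close> is 0 also when the square
  is not integrable.\<close>

lemma AE_zero_L2:
  fixes f :: "'a::euclidean_space \<Rightarrow> real"
  assumes "S \<in> sets lebesgue" "negligible N" "\<And>x. x \<in> S - N \<Longrightarrow> f x = 0"
  shows "f \<in> L2 S" "L2norm S f = 0"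
proof -
  have f: "f \<in> borel_measurable (lebesgue_on S)"
    by (rule borel_measurable_lebesgue_on_spike[of "\<lambda>_. 0", OF _ assms(2,3)]) auto
  have ae: "AE x in lebesgue_on S. (f x)\<^sup>2 = 0"
    using assms by (intro AE_lebesgue_onI) auto
  then have "integrable (lebesgue_on S) (\<lambda>x. (f x)\<^sup>2)"
    using f by (subst integrable_cong_AE[where g="\<lambda>_. 0"]) auto
  then show "f \<in> L2 S"
    using f by (simp add: L2_def)
  show "L2norm S f = 0"
    using integral_eq_zero_AE[OF ae] by (simp add: L2norm_def)
qed

text \<open>Weak derivatives are not unique as functions, so their existence is asserted first and
  the norm identity then covers every choice; the memberships in \<open>L2\<close> keep the norms
  from being default values.\<close>

theorem lemma5p1:
  fixes \<alpha>\<^sub>1 \<alpha>\<^sub>2 \<epsilon> :: real and X :: "real^2 \<Rightarrow> real"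
  assumes "\<alpha>\<^sub>1 < \<alpha>\<^sub>2"
    and "\<And>x. x \<in> \<Omega>\<^sub>1 \<Longrightarrow> X x = \<alpha>\<^sub>1"
    and "\<And>x. x \<in> \<Omega>\<^sub>2 \<Longrightarrow> X x = \<alpha>\<^sub>2"
    and "\<epsilon> > 0"
    and "\<And>\<xi> c. \<xi> \<in> {\<xi>\<^sub>1, \<xi>\<^sub>2} \<Longrightarrow> c \<in> {lev + \<epsilon>, lev - \<epsilon>} \<Longrightarrow> \<Omega> \<inter> {x. \<xi> \<bullet> x = c} \<noteq> {}"
  shows "(\<lambda>x. X x - p \<alpha>\<^sub>1 \<alpha>\<^sub>2 \<epsilon> x) \<in> L2 \<Omega> \<and>
    (\<exists>X\<beta>. has_piecewise_weak_deriv {\<Upsilon>\<^sub>1, \<Upsilon>\<^sub>2} \<beta> X X\<beta>) \<and>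
    (\<exists>p\<beta>. has_piecewise_weak_deriv {\<Upsilon>\<^sub>1, \<Upsilon>\<^sub>2} \<beta> (p \<alpha>\<^sub>1 \<alpha>\<^sub>2 \<epsilon>) p\<beta>) \<and>
    (\<forall>X\<beta> p\<beta>.
       has_piecewise_weak_deriv {\<Upsilon>\<^sub>1, \<Upsilon>\<^sub>2} \<beta> X X\<beta> \<longrightarrow>
       has_piecewise_weak_deriv {\<Upsilon>\<^sub>1, \<Upsilon>\<^sub>2} \<beta> (p \<alpha>\<^sub>1 \<alpha>\<^sub>2 \<epsilon>) p\<beta> \<longrightarrow>
       (\<lambda>x. X\<beta> x - p\<beta> x) \<in> L2 \<Omega> \<and>
       L2norm \<Omega> (\<lambda>x. X x - p \<alpha>\<^sub>1 \<alpha>\<^sub>2 \<epsilon> x) =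
         sqrt ((L2norm \<Omega> (\<lambda>x. X x - p \<alpha>\<^sub>1 \<alpha>\<^sub>2 \<epsilon> x))\<^sup>2 + (L2norm \<Omega> (\<lambda>x. X\<beta> x - p\<beta> x))\<^sup>2) \<and>
       sqrt ((L2norm \<Omega> (\<lambda>x. X x - p \<alpha>\<^sub>1 \<alpha>\<^sub>2 \<epsilon> x))\<^sup>2 + (L2norm \<Omega> (\<lambda>x. X\<beta> x - p\<beta> x))\<^sup>2)
         \<le> sqrt (2/3) * diameter \<Omega> powr ((real DIM(real^2) - 1) / 2) * \<bar>\<alpha>\<^sub>1 - \<alpha>\<^sub>2\<bar> * sqrt \<epsilon>)"
proof -
  let ?L = "{x. \<xi>\<^sub>1 \<bullet> x = lev} \<union> {x. \<xi>\<^sub>2 \<bullet> x = lev}"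
  let ?f = "\<lambda>x. X x - p \<alpha>\<^sub>1 \<alpha>\<^sub>2 \<epsilon> x"
  have X: "X x = step \<alpha>\<^sub>1 \<alpha>\<^sub>2 (region_normal x) x" if "x \<in> \<Omega> - ?L" for x
    using that by (intro X_eq_step assms(2,3)) auto
  note p = p_eq_ramp[OF assms(1,4)]
  have region: "region_normal x = \<xi>\<^sub>1" "x \<in> \<Omega>" if "x \<in> \<Upsilon>\<^sub>1" for x
    using that by (auto simp: region_normal_def \<Upsilon>\<^sub>1_def)
  have region': "region_normal x = \<xi>\<^sub>2" "x \<in> \<Omega>" if "x \<in> \<Upsilon>\<^sub>2" for x
    using that by (auto simp: region_normal_def \<Upsilon>\<^sub>2_def)
  have X0: "has_piecewise_weak_deriv {\<Upsilon>\<^sub>1, \<Upsilon>\<^sub>2} \<beta> X (\<lambda>_. 0)"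
    by (rule piecewise_weak_deriv_zero[OF negligible_level, where C="\<bar>\<alpha>\<^sub>1\<bar> + \<bar>\<alpha>\<^sub>2\<bar>"
          and H\<^sub>1 = "step \<alpha>\<^sub>1 \<alpha>\<^sub>2 \<xi>\<^sub>1" and H\<^sub>2 = "step \<alpha>\<^sub>1 \<alpha>\<^sub>2 \<xi>\<^sub>2"])
      (use X region region' borel_measurable_step in \<open>auto simp: step_def\<close>)
  \<comment> \<open>The formula for \<open>p\<close> holds at every point, so the exceptional set is
    empty here, unlike for \<open>X\<close>.\<close>
  have p0: "has_piecewise_weak_deriv {\<Upsilon>\<^sub>1, \<Upsilon>\<^sub>2} \<beta> (p \<alpha>\<^sub>1 \<alpha>\<^sub>2 \<epsilon>) (\<lambda>_. 0)"
  proof (rule piecewise_weak_deriv_zero[OF negligible_empty, where C="\<bar>\<alpha>\<^sub>1\<bar> + \<bar>\<alpha>\<^sub>2\<bar>"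
        and H\<^sub>1 = "ramp \<alpha>\<^sub>1 \<alpha>\<^sub>2 \<epsilon> \<xi>\<^sub>1" and H\<^sub>2 = "ramp \<alpha>\<^sub>1 \<alpha>\<^sub>2 \<epsilon> \<xi>\<^sub>2"])
    show "\<bar>ramp \<alpha>\<^sub>1 \<alpha>\<^sub>2 \<epsilon> \<xi>\<^sub>1 x\<bar> \<le> \<bar>\<alpha>\<^sub>1\<bar> + \<bar>\<alpha>\<^sub>2\<bar>" "\<bar>ramp \<alpha>\<^sub>1 \<alpha>\<^sub>2 \<epsilon> \<xi>\<^sub>2 x\<bar> \<le> \<bar>\<alpha>\<^sub>1\<bar> + \<bar>\<alpha>\<^sub>2\<bar>" for x
      using ramp_bounds[OF assms(1,4), of _ x] by (smt (verit))+
  qed (use p region region' borel_measurable_ramp in \<open>auto simp: ramp_def\<close>)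
  have \<Omega>: "\<Omega> \<in> sets lebesgue"
    using open_\<Omega> by auto
  let ?d = "(\<alpha>\<^sub>2 - \<alpha>\<^sub>1)\<^sup>2 / 16"
  \<comment> \<open>Both strips are counted over all of \<Omega>. The extra summand is nonnegative,
    and no strip has to be cut along the diagonal.\<close>
  define F where "F x = ?d * (indicat_real (strip \<xi>\<^sub>1 \<epsilon>) x + 3 * indicat_real (strip \<xi>\<^sub>1 (\<epsilon> / 2)) x) +
    ?d * (indicat_real (strip \<xi>\<^sub>2 \<epsilon>) x + 3 * indicat_real (strip \<xi>\<^sub>2 (\<epsilon> / 2)) x)" for x
  have "(?f x)\<^sup>2 \<le> F x" if "x \<in> \<Omega> - ?L" for x
  proof -
    have "(?f x)\<^sup>2 \<le> ?d * (indicator (strip (region_normal x) \<epsilon>) x + 3 * indicator (strip (region_normal x) (\<epsilon> / 2)) x)"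
      unfolding X[OF that] p using assms that by (intro step_minus_ramp_bound) auto
    also have "\<dots> \<le> F x"
      unfolding F_def by (auto simp: region_normal_def)
    finally show ?thesis .
  qed
  then have le: "AE x in lebesgue_on \<Omega>. (?f x)\<^sup>2 \<le> F x"
    by (rule AE_lebesgue_onI[OF \<Omega> negligible_level])
  have f: "?f \<in> borel_measurable (lebesgue_on \<Omega>)"
  proof (rule borel_measurable_lebesgue_on_spike[OF _ negligible_level])
    have "{x :: real^2. x $ 2 < x $ 1} \<in> sets borel"
      by (intro borel_open open_Collect_less continuous_intros)
    then have "(\<lambda>x. if x $ 2 < x $ 1 then step \<alpha>\<^sub>1 \<alpha>\<^sub>2 \<xi>\<^sub>1 x - ramp \<alpha>\<^sub>1 \<alpha>\<^sub>2 \<epsilon> \<xi>\<^sub>1 x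
        else step \<alpha>\<^sub>1 \<alpha>\<^sub>2 \<xi>\<^sub>2 x - ramp \<alpha>\<^sub>1 \<alpha>\<^sub>2 \<epsilon> \<xi>\<^sub>2 x) \<in> borel_measurable borel"
      by (intro measurable_If borel_measurable_diff borel_measurable_step borel_measurable_ramp) auto
    then show "(\<lambda>x. step \<alpha>\<^sub>1 \<alpha>\<^sub>2 (region_normal x) x - ramp \<alpha>\<^sub>1 \<alpha>\<^sub>2 \<epsilon> (region_normal x) x) \<in> borel_measurable borel"
      by (rule back_subst[of "\<lambda>h. h \<in> borel_measurable borel"]) (auto simp: region_normal_def)
  qed (use X p in auto)
  have int: "integrable (lebesgue_on \<Omega>) (indicat_real (strip \<xi> r))"
    and strip: "(\<integral>x. indicat_real (strip \<xi> r) x \<partial>lebesgue_on \<Omega>) = measure lebesgue (strip \<xi> r)" for \<xi> r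
  proof -
    have sub: "strip \<xi> r \<subseteq> \<Omega>" and S: "strip \<xi> r \<in> sets lebesgue"
      using open_strip by (auto simp: strip_def)
    have "strip \<xi> r \<in> sets (lebesgue_on \<Omega>)"
      using sub S \<Omega> by (simp add: sets_restrict_space_iff)
    moreover have "emeasure (lebesgue_on \<Omega>) (strip \<xi> r) < \<infinity>"
      using sub \<Omega> lmeasurable_strip[of \<xi> r]
      by (subst emeasure_restrict_space) (auto simp: fmeasurable_def)
    ultimately show "integrable (lebesgue_on \<Omega>) (indicat_real (strip \<xi> r))"
      by (rule integrable_real_indicator)
    show "(\<integral>x. indicat_real (strip \<xi> r) x \<partial>lebesgue_on \<Omega>) = measure lebesgue (strip \<xi> r)"
      using sub \<Omega> by (simp add: measure_restrict_space Int_absorb2)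
  qed
  have F: "integrable (lebesgue_on \<Omega>) F"
    unfolding F_def
    by (intro Bochner_Integration.integrable_add integrable_mult_right int)
  have f2: "integrable (lebesgue_on \<Omega>) (\<lambda>x. (?f x)\<^sup>2)"
    by (rule Bochner_Integration.integrable_bound[OF F]) (use f le in auto)
  have L2: "?f \<in> L2 \<Omega>"
    using f f2 by (simp add: L2_def)
  have "(\<integral>x. (?f x)\<^sup>2 \<partial>lebesgue_on \<Omega>) \<le> (\<integral>x. F x \<partial>lebesgue_on \<Omega>)"
    by (rule integral_mono_AE[OF f2 F le])
  also have "\<dots> = ?d * (measure lebesgue (strip \<xi>\<^sub>1 \<epsilon>) + 3 * measure lebesgue (strip \<xi>\<^sub>1 (\<epsilon> / 2))) +
      ?d * (measure lebesgue (strip \<xi>\<^sub>2 \<epsilon>) + 3 * measure lebesgue (strip \<xi>\<^sub>2 (\<epsilon> / 2)))"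
    unfolding F_def
    by (simp only: Bochner_Integration.integral_add Bochner_Integration.integrable_add
        integrable_mult_right int integral_mult_right_zero strip)
  also have "\<dots> \<le> ?d * (2 * \<epsilon> + 3 * (2 * (\<epsilon> / 2))) + ?d * (2 * \<epsilon> + 3 * (2 * (\<epsilon> / 2)))"
    using assms(4) by (intro add_mono mult_left_mono measure_strip) auto
  \<comment> \<open>Each strip direction contributes 5 * \<epsilon> times 1/16 of the squared
    jump.\<close>
  also have "\<dots> = 5 / 8 * ((\<alpha>\<^sub>1 - \<alpha>\<^sub>2)\<^sup>2 * \<epsilon>)"
    by (simp add: power2_commute)
  \<comment> \<open>Here 5/8 < 2/3, and the diameter is at least 1.\<close>
  also have "\<dots> \<le> 2 / 3 * diameter \<Omega> * ((\<alpha>\<^sub>1 - \<alpha>\<^sub>2)\<^sup>2 * \<epsilon>)"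
    using diameter_\<Omega> assms(4) by (intro mult_right_mono) auto
  finally have "L2norm \<Omega> ?f \<le> sqrt (2 / 3 * diameter \<Omega> * ((\<alpha>\<^sub>1 - \<alpha>\<^sub>2)\<^sup>2 * \<epsilon>))"
    unfolding L2norm_def by (rule real_sqrt_le_mono)
  \<comment> \<open>The dimension is 2, so the exponent is 1/2 and the power is a square
    root.\<close>
  also have "\<dots> = sqrt (2/3) * diameter \<Omega> powr ((real DIM(real^2) - 1) / 2) * \<bar>\<alpha>\<^sub>1 - \<alpha>\<^sub>2\<bar> * sqrt \<epsilon>"
    using diameter_\<Omega> by (simp only: real_sqrt_mult) (simp add: powr_half_sqrt)
  finally have bound: "L2norm \<Omega> ?f \<le> sqrt (2/3) * diameter \<Omega> powr ((real DIM(real^2) - 1) / 2) * \<bar>\<alpha>\<^sub>1 - \<alpha>\<^sub>2\<bar> * sqrt \<epsilon>" .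
  have nonneg: "0 \<le> L2norm \<Omega> ?f"
    by (simp add: L2norm_def)
  have zero: "(\<lambda>x. X\<beta> x - p\<beta> x) \<in> L2 \<Omega> \<and> L2norm \<Omega> (\<lambda>x. X\<beta> x - p\<beta> x) = 0"
    if "has_piecewise_weak_deriv {\<Upsilon>\<^sub>1, \<Upsilon>\<^sub>2} \<beta> X X\<beta>"
      "has_piecewise_weak_deriv {\<Upsilon>\<^sub>1, \<Upsilon>\<^sub>2} \<beta> (p \<alpha>\<^sub>1 \<alpha>\<^sub>2 \<epsilon>) p\<beta>" for X\<beta> p\<beta>
  proof -
    \<comment> \<open>Uniqueness against the zero derivatives puts the nonzero values of any choice
      into a common null set.\<close>
    have N: "negligible ({x \<in> \<Omega>. X\<beta> x \<noteq> 0} \<union> {x \<in> \<Omega>. p\<beta> x \<noteq> 0})"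
      using that by (intro negligible_Un piecewise_weak_deriv_zero_unique[OF X0] piecewise_weak_deriv_zero_unique[OF p0])
    show ?thesis
      by (intro conjI AE_zero_L2[OF \<Omega> N]) auto
  qed
  show ?thesis
  proof (intro conjI allI impI exI)
    show "?f \<in> L2 \<Omega>"
      by (rule L2)
    show "has_piecewise_weak_deriv {\<Upsilon>\<^sub>1, \<Upsilon>\<^sub>2} \<beta> X (\<lambda>_. 0)"
      by (rule X0)
    show "has_piecewise_weak_deriv {\<Upsilon>\<^sub>1, \<Upsilon>\<^sub>2} \<beta> (p \<alpha>\<^sub>1 \<alpha>\<^sub>2 \<epsilon>) (\<lambda>_. 0)"
      by (rule p0)
    fix X\<beta> p\<beta>
    assume "has_piecewise_weak_deriv {\<Upsilon>\<^sub>1, \<Upsilon>\<^sub>2} \<beta> X X\<beta>"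
      "has_piecewise_weak_deriv {\<Upsilon>\<^sub>1, \<Upsilon>\<^sub>2} \<beta> (p \<alpha>\<^sub>1 \<alpha>\<^sub>2 \<epsilon>) p\<beta>"
    note z = zero[OF this]
    show "(\<lambda>x. X\<beta> x - p\<beta> x) \<in> L2 \<Omega>"
      using z by (rule conjunct1)
    show eq: "L2norm \<Omega> ?f = sqrt ((L2norm \<Omega> ?f)\<^sup>2 + (L2norm \<Omega> (\<lambda>x. X\<beta> x - p\<beta> x))\<^sup>2)"
      unfolding z[THEN conjunct2] using nonneg by simp
    show "sqrt ((L2norm \<Omega> ?f)\<^sup>2 + (L2norm \<Omega> (\<lambda>x. X\<beta> x - p\<beta> x))\<^sup>2)
        \<le> sqrt (2/3) * diameter \<Omega> powr ((real DIM(real^2) - 1) / 2) * \<bar>\<alpha>\<^sub>1 - \<alpha>\<^sub>2\<bar> * sqrt \<epsilon>"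
      using bound unfolding eq[symmetric] .
  qed
qed

end
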